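(* Let $\nu>-1/2$, $0\le|\beta|<\alpha$, $\mu\in\mathbb{R}$ and let $X\sim\mathrm{VG}(\nu,\alpha,\beta,\mu)$. Then $$X-\mathbb{E}[X]\sim\mathrm{VG}\Big(\nu,\alpha,\beta,-\frac{(2\nu+1)\beta}{\alpha^2-\beta^2}\Big).$$ Consequently, writing $\mu_0=-(2\nu+1)\beta/(\alpha^2-\beta^2)$ and, for integers $k\ge0$, $p_k=\lceil k/2\rceil+1/2$ and $q_k=k\bmod2\in\{0,1\}$, for every $r\in\{2,4,6,\ldots\}$, $$\mathbb{E}\big[|X-\mathbb{E}[X]|^r\big]=\frac{(1-\beta^2/\alpha^2)^{\nu+1/2}}{\sqrt{\pi}\,\alpha^r\,\Gamma(\nu+1/2)}\sum_{k=0}^r\binom{r}{k}2^k(\alpha\mu_0)^{r-k}\Big(\frac{2\beta}{\alpha}\Big)^{q_k}\Gamma(\nu+p_k)\Gamma(p_k)\,{}_2F_1\Big(p_k,\nu+p_k;\tfrac12+q_k;\tfrac{\beta^2}{\alpha^2}\Big).$$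
   Context: $\mathrm{VG}(\nu,\alpha,\beta,\mu)$ denotes the variance-gamma distribution, with probability density function on $\mathbb{R}$ $$p(x)=\frac{(\alpha^2-\beta^2)^{\nu+1/2}}{\sqrt{\pi}(2\alpha)^\nu\Gamma(\nu+1/2)}\,\mathrm{e}^{\beta(x-\mu)}|x-\mu|^\nu K_\nu(\alpha|x-\mu|),$$ where $K_\nu$ is the modified Bessel function of the second kind. ${}_2F_1$ is the Gauss hypergeometric function. Convention: $0^0=1$. *)

theory Defs
  imports "HOL-Probability.Probability"
begin

(* The integral converges for x > 0; the junk value at x = 0 only enters the
   density below at the single point x = \<mu>. *)
definition bessel_K :: "real \<Rightarrow> real \<Rightarrow> real" where
  "bessel_K \<nu> x = (LBINT t:{0..}. exp (- x * cosh t) * cosh (\<nu> * t))"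

definition hypergeo_2F1 :: "real \<Rightarrow> real \<Rightarrow> real \<Rightarrow> real \<Rightarrow> real" where
  "hypergeo_2F1 a b c z =
     (\<Sum>n. pochhammer a n * pochhammer b n / (pochhammer c n * fact n) * z ^ n)"

definition vg_density :: "real \<Rightarrow> real \<Rightarrow> real \<Rightarrow> real \<Rightarrow> real \<Rightarrow> real" where
  "vg_density \<nu> \<alpha> \<beta> \<mu> x =
     (\<alpha>\<^sup>2 - \<beta>\<^sup>2) powr (\<nu> + 1/2) / (sqrt pi * (2 * \<alpha>) powr \<nu> * Gamma (\<nu> + 1/2))
       * exp (\<beta> * (x - \<mu>)) * \<bar>x - \<mu>\<bar> powr \<nu> * bessel_K \<nu> (\<alpha> * \<bar>x - \<mu>\<bar>)"

definition has_VG :: "'a measure \<Rightarrow> ('a \<Rightarrow> real) \<Rightarrow> real \<Rightarrow> real \<Rightarrow> real \<Rightarrow> real \<Rightarrow> bool" where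
  "has_VG M X \<nu> \<alpha> \<beta> \<mu> \<longleftrightarrow> distributed M lborel X (\<lambda>x. ennreal (vg_density \<nu> \<alpha> \<beta> \<mu> x))"

definition p_idx :: "nat \<Rightarrow> real" where
  "p_idx k = of_int \<lceil>real k / 2\<rceil> + 1/2"

definition q_idx :: "nat \<Rightarrow> nat" where
  "q_idx k = k mod 2"

end

theory Submission
  imports Defs
begin

text \<open>
  After a translation the location parameter is 0. By Fubini and the Gamma and Beta integrals, the
  Mellin transform of \<open>K\<^sub>\<nu>\<close> is
  \<open>\<integral>\<^sub>0\<^sup>\<infinity> x\<^bsup>s-1\<^esup> K\<^sub>\<nu>(\<alpha>x) dx = 2\<^bsup>s-2\<^esup> \<alpha>\<^bsup>-s\<^esup> \<Gamma>((s+\<nu>)/2) \<Gamma>((s-\<nu>)/2)\<close>.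
  Folding the line onto the positive half-line turns \<open>e\<^bsup>\<beta>x\<^esup>\<close> into \<open>2 cosh (\<beta>x)\<close> or \<open>2 sinh (\<beta>x)\<close>, according to
  the parity of the order of the moment, and termwise integration of its power series yields the
  \<open>\<^sub>2F\<^sub>1\<close>. For the first moment this series is \<open>\<^sub>2F\<^sub>1(3/2, \<nu>+3/2; 3/2; z) = (1-z)\<^bsup>-\<nu>-3/2\<^esup>\<close>, which identifies
  the mean; the central moments of even order follow from the binomial theorem.
\<close>

section \<open>The Mellin transform of the Bessel function\<close>

text \<open>For a nonnegative integrand, gauge integrability is absolute integrability; Borel
  measurability then passes from \<open>lebesgue\<close> to \<open>lborel\<close>, and uniqueness of
  the gauge integral fixes the value. Makes the gauge forms of the Gamma and Beta integrals usable
  with Fubini.\<close>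

lemma has_bochner_integral_lborel_of_has_integral:
  fixes f :: "real \<Rightarrow> real"
  assumes I: "(f has_integral I) S" and nn: "\<And>x. x \<in> S \<Longrightarrow> 0 \<le> f x"
    and S [measurable]: "S \<in> sets borel" and f [measurable]: "f \<in> borel_measurable borel"
  shows "has_bochner_integral lborel (\<lambda>x. indicator S x * f x) I"
proof -
  have "f absolutely_integrable_on S"
    using I nn by (intro nonnegative_absolutely_integrable_1) (auto simp: has_integral_integrable)
  then have "integrable lebesgue (\<lambda>x. indicator S x * f x)"
    by (simp add: set_integrable_def)
  then have int: "integrable lborel (\<lambda>x. indicator S x * f x)"
    by (subst (asm) integrable_completion) auto
  have "((\<lambda>x. indicator S x * f x) has_integral (\<integral>x. indicator S x * f x \<partial>lborel)) UNIV"
    by (rule has_integral_integral_lborel[OF int])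
  moreover have "((\<lambda>x. indicator S x * f x) has_integral I) UNIV"
  proof -
    have "(\<lambda>x. indicator S x * f x) = (\<lambda>x. if x \<in> S then f x else 0)"
      by (auto simp: indicator_def)
    then show ?thesis using I by (simp add: has_integral_restrict_UNIV)
  qed
  ultimately have "(\<integral>x. indicator S x * f x \<partial>lborel) = I"
    by (rule has_integral_unique)
  with int show ?thesis by (simp add: has_bochner_integral_iff)
qed

text \<open>The reflection of \<open>x\<close> to \<open>- x\<close> moves the negative half-line to
  the positive one; the point 0, which neither indicator covers, is a null set.\<close>

lemma has_bochner_integral_lborel_half_lines:
  fixes f :: "real \<Rightarrow> real"
  assumes f [measurable]: "f \<in> borel_measurable borel"
    and a: "has_bochner_integral lborel (\<lambda>x. indicator {0<..} x * f x) a"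
    and b: "has_bochner_integral lborel (\<lambda>x. indicator {0<..} x * f (- x)) b"
  shows "has_bochner_integral lborel f (a + b)"
proof -
  have b': "has_bochner_integral lborel (\<lambda>x. indicator {..<0} x * f x) b"
  proof (subst lborel_has_bochner_integral_real_affine_iff[where c = "-1" and t = 0])
    have eq: "(\<lambda>x. indicator {..<0} (0 + - 1 * x) * f (0 + - 1 * x)) = (\<lambda>x::real. indicator {0<..} x * f (- x))"
      by (auto simp: indicator_def fun_eq_iff)
    show "has_bochner_integral lborel (\<lambda>x. indicator {..<0} (0 + - 1 * x) * f (0 + - 1 * x)) (b /\<^sub>R \<bar>- 1\<bar>)"
      unfolding eq using b by simp
  qed simp
  have "AE x in lborel. (x::real) \<noteq> 0" by (rule AE_lborel_singleton)
  then have ae: "AE x in lborel. indicator {0<..} x * f x + indicator {..<0} x * f x = f x"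
    by eventually_elim (auto simp: indicator_def)
  show ?thesis
    by (rule iffD1[OF has_bochner_integral_cong_AE[OF _ _ ae] has_bochner_integral_add[OF a b']])
       simp_all
qed

text \<open>Both open half-lines contribute equally. Closing the half-line at the null point 0 gives
  the domain of integration in \<open>bessel_K_def\<close>.\<close>

lemma has_bochner_integral_lborel_even:
  fixes h :: "real \<Rightarrow> real"
  assumes even: "\<And>x. h (- x) = h x" and h: "has_bochner_integral lborel h I"
  shows "has_bochner_integral lborel (\<lambda>x. indicator {0..} x * h x) (I / 2)"
proof -
  have int: "integrable lborel h" and [measurable]: "h \<in> borel_measurable borel"
    using h by (auto simp: has_bochner_integral_iff)
  define a where "a = (\<integral>x. indicator {0<..} x * h x \<partial>lborel)"
  have a: "has_bochner_integral lborel (\<lambda>x. indicator {0<..} x * h x) a"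
    using integrable_mult_indicator[OF _ int, of "{0<..}"] by (simp add: a_def has_bochner_integral_iff)
  have "has_bochner_integral lborel h (a + a)"
    by (rule has_bochner_integral_lborel_half_lines) (use a even in simp_all)
  with h have "a = I / 2" using has_bochner_integral_eq by fastforce
  have "AE x in lborel. (x::real) \<noteq> 0" by (rule AE_lborel_singleton)
  then have ae: "AE x in lborel. indicator {0<..} x * h x = indicator {0..} x * h x"
    by eventually_elim (auto simp: indicator_def)
  show ?thesis
    using a unfolding \<open>a = I / 2\<close>
    by (rule iffD1[OF has_bochner_integral_cong_AE[OF _ _ ae], rotated 2]) simp_all
qed

section \<open>Gamma and Beta integrals\<close>

text \<open>Substitute \<open>c * x\<close> in Euler's integral; the factor
  \<open>c powr (1 - s)\<close> cancels the power of \<open>c\<close> that the substitution produces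
  in the integrand.\<close>

lemma has_bochner_integral_Gamma_scaled:
  fixes s c :: real
  assumes s: "s > 0" and c: "c > 0"
  shows "has_bochner_integral lborel (\<lambda>x. indicator {0<..} x * (x powr (s - 1) * exp (- c * x)))
           (Gamma s * c powr (- s))"
proof -
  have "has_bochner_integral lborel (\<lambda>x. indicator {0..} x * (x powr (s - 1) / exp x)) (Gamma s)"
    using Gamma_integral_real[OF s] by (rule has_bochner_integral_lborel_of_has_integral) auto
  \<comment> \<open>The half-line may be opened pointwise: \<open>0 powr (s - 1)\<close> is 0 for
    every \<open>s\<close>.\<close>
  also have "(\<lambda>x. indicator {0..} x * (x powr (s - 1) / exp x)) =
      (\<lambda>x::real. indicator {0<..} x * (x powr (s - 1) / exp x))"
    by (auto simp: indicator_def fun_eq_iff)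
  finally have G: "has_bochner_integral lborel
      (\<lambda>x::real. indicator {0<..} x * (x powr (s - 1) / exp x)) (Gamma s)" .
  have "has_bochner_integral lborel
      (\<lambda>x. indicator {0<..} (0 + c * x) * ((0 + c * x) powr (s - 1) / exp (0 + c * x))) (Gamma s /\<^sub>R \<bar>c\<bar>)"
    using G c by (subst (asm) lborel_has_bochner_integral_real_affine_iff[where c = c and t = 0]) auto
  then have "has_bochner_integral lborel
      (\<lambda>x. c powr (1 - s) * (indicator {0<..} (0 + c * x) * ((0 + c * x) powr (s - 1) / exp (0 + c * x))))
      (c powr (1 - s) * (Gamma s /\<^sub>R \<bar>c\<bar>))"
    by (rule has_bochner_integral_mult_right)
  also have "(\<lambda>x. c powr (1 - s) * (indicator {0<..} (0 + c * x) * ((0 + c * x) powr (s - 1) / exp (0 + c * x))))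
     = (\<lambda>x. indicator {0<..} x * (x powr (s - 1) * exp (- c * x)))"
  proof
    fix x
    have "c powr (1 - s) * c powr (s - 1) = 1"
      using c by (simp flip: powr_add)
    then show "c powr (1 - s) * (indicator {0<..} (0 + c * x) * ((0 + c * x) powr (s - 1) / exp (0 + c * x)))
       = indicator {0<..} x * (x powr (s - 1) * exp (- c * x))"
      using c by (auto simp: indicator_def powr_mult exp_minus divide_inverse zero_less_mult_iff)
  qed
  also have "c powr (1 - s) * (Gamma s /\<^sub>R \<bar>c\<bar>) = Gamma s * c powr (- s)"
    using c by (simp add: powr_diff powr_minus field_simps)
  finally show ?thesis .
qed

text \<open>A hyperbolic form of the Beta integral; \<bar>\<nu>\<bar> < s says exactly that both
  Beta arguments are positive.\<close>

lemma has_bochner_integral_exp_cosh_powr: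
  fixes s \<nu> :: real
  assumes "\<bar>\<nu>\<bar> < s"
  shows "has_bochner_integral lborel (\<lambda>t. exp (\<nu> * t) * cosh t powr (- s))
           (2 powr (s - 1) * Beta ((s + \<nu>) / 2) ((s - \<nu>) / 2))"
proof -
  define a b where "a = (s + \<nu>) / 2" and "b = (s - \<nu>) / 2"
  have ab: "a > 0" "b > 0" using assms by (auto simp: a_def b_def)
  \<comment> \<open>Substitute u = g(t) in the Beta integral: g(t) = e^t / (2 cosh t), 1 - g(t) = e^(-t) / (2 cosh t)
    and g' = 2 g (1 - g).\<close>
  define g :: "real \<Rightarrow> real" where "g = (\<lambda>t. 1 / (1 + exp (- 2 * t)))"
  define f where "f = (\<lambda>u::real. u powr (a - 1) * (1 - u) powr (b - 1))"
  have pos: "1 + exp (- 2 * t) > 0" for t :: real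
    by (intro add_pos_pos) auto
  have g01: "0 < g t" "g t < 1" for t
    using pos[of t] by (auto simp: g_def)
  have im: "range g = {0<..<1}"
  proof (intro set_eqI iffI)
    fix u :: real assume u: "u \<in> {0<..<1}"
    \<comment> \<open>The preimage comes from solving \<open>u = 1 / (1 + exp (- 2 * t))\<close> for
      \<open>t\<close>.\<close>
    have "g (- ln (1 / u - 1) / 2) = u"
      using u by (simp add: g_def field_simps)
    then show "u \<in> range g" by (metis rangeI)
  qed (use g01 in auto)
  have inj: "inj g" 
    using pos by (auto simp: inj_on_def g_def)
  have der: "(g has_field_derivative 2 * g t * (1 - g t)) (at t)" for t
    unfolding g_def using pos[of t]
    by (auto intro!: derivative_eq_intros simp: divide_simps power2_eq_square)
  have fint: "(f has_integral Beta a b) {0<..<1}"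
    using has_integral_Beta_real[OF ab] by (simp add: f_def has_integral_Icc_iff_Ioo)
  have "f absolutely_integrable_on range g \<and> integral (range g) f = Beta a b"
    unfolding im using fint
    by (intro conjI nonnegative_absolutely_integrable_1) (auto simp: f_def has_integral_integrable integral_unique)
  then have "(\<lambda>t. \<bar>2 * g t * (1 - g t)\<bar> * f (g t)) absolutely_integrable_on UNIV
      \<and> integral UNIV (\<lambda>t. \<bar>2 * g t * (1 - g t)\<bar> * f (g t)) = Beta a b"
    by (subst has_absolute_integral_change_of_variables_1') (use der inj in auto)
  then have "((\<lambda>t. \<bar>2 * g t * (1 - g t)\<bar> * f (g t)) has_integral Beta a b) UNIV"
    by (auto simp: has_integral_iff set_lebesgue_integral_eq_integral)
  moreover have "\<bar>2 * g t * (1 - g t)\<bar> * f (g t) = 2 powr (1 - s) * (exp (\<nu> * t) * cosh t powr (- s))" for t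
  proof -
    have g1: "g t = exp t / (2 * cosh t)"
    proof -
      have "2 * cosh t = exp t * (1 + exp (- 2 * t))"
        by (simp add: cosh_field_def distrib_left flip: exp_add)
      then show ?thesis by (simp add: g_def)
    qed
    have g2: "1 - g t = exp (- t) / (2 * cosh t)"
    proof -
      have "2 * cosh t \<noteq> 0" by simp
      moreover have "2 * cosh t - exp t = exp (- t)" by (simp add: cosh_field_def add_divide_distrib)
      ultimately show ?thesis by (simp add: g1 diff_divide_eq_iff)
    qed
    have quot_powr: "(exp u / (2 * cosh t)) powr e = exp (e * u) * (2 * cosh t) powr (- e)" for u e
    proof -
      have "(exp u / y) powr e = exp (e * u) * y powr (- e)" if "y > 0" for y
        using that by (simp add: powr_def ln_div right_diff_distrib exp_diff exp_minus field_simps)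
      then show ?thesis by simp
    qed
    \<comment> \<open>The Jacobian raises the exponents \<open>a - 1\<close> and
      \<open>b - 1\<close> to \<open>a\<close> and \<open>b\<close>. Then
      \<open>a - b = \<nu>\<close> is the rate of the exponential and \<open>a + b = s\<close> the
      exponent of cosh.\<close>
    have "\<bar>2 * g t * (1 - g t)\<bar> * f (g t) = 2 * (g t powr a * (1 - g t) powr b)"
      using g01[of t] by (simp add: f_def powr_diff abs_mult)
    also have "g t powr a = exp (a * t) * (2 * cosh t) powr (- a)"
      unfolding g1 by (rule quot_powr)
    also have "(1 - g t) powr b = exp (- b * t) * (2 * cosh t) powr (- b)"
      unfolding g2 using quot_powr[of "- t" b] by simp
    also have "2 * (exp (a * t) * (2 * cosh t) powr (- a) * (exp (- b * t) * (2 * cosh t) powr (- b)))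
       = 2 * (exp (a * t) * exp (- b * t)) * ((2 * cosh t) powr (- a) * (2 * cosh t) powr (- b))"
      by simp
    also have "exp (a * t) * exp (- b * t) = exp (\<nu> * t)"
    proof -
      have "a * t + - b * t = \<nu> * t" by (simp add: a_def b_def field_simps)
      then show ?thesis by (simp only: flip: exp_add)
    qed
    also have "(2 * cosh t) powr (- a) * (2 * cosh t) powr (- b) = (2 * cosh t) powr (- s)"
    proof -
      have "- a + - b = - s" by (simp add: a_def b_def field_simps)
      then show ?thesis by (simp only: flip: powr_add)
    qed
    also have "2 * exp (\<nu> * t) * (2 * cosh t) powr (- s) = 2 powr (1 - s) * (exp (\<nu> * t) * cosh t powr (- s))"
      by (simp add: powr_mult powr_diff powr_minus divide_inverse)
    finally show ?thesis .
  qed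
  ultimately have "((\<lambda>t. 2 powr (1 - s) * (exp (\<nu> * t) * cosh t powr (- s))) has_integral Beta a b) UNIV"
    by simp
  then have "has_bochner_integral lborel
      (\<lambda>t. indicator UNIV t * (2 powr (1 - s) * (exp (\<nu> * t) * cosh t powr (- s)))) (Beta a b)"
    by (rule has_bochner_integral_lborel_of_has_integral) (auto simp: cosh_field_def)
  from has_bochner_integral_mult_right[OF this, of "2 powr (s - 1)"]
  show ?thesis by (simp add: a_def b_def flip: powr_add mult.assoc)
qed

text \<open>Averaging over \<nu> and -\<nu> turns exp into cosh and keeps the value, Beta being
  symmetric; restricting the even integrand to a half-line halves it, hence \<open>s - 2\<close> in
  place of \<open>s - 1\<close>.\<close>

lemma has_bochner_integral_cosh_cosh_powr:
  fixes s \<nu> :: real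
  assumes "\<bar>\<nu>\<bar> < s"
  shows "has_bochner_integral lborel (\<lambda>t. indicator {0..} t * (cosh (\<nu> * t) * cosh t powr (- s)))
           (2 powr (s - 2) * Beta ((s + \<nu>) / 2) ((s - \<nu>) / 2))"
proof -
  let ?B = "2 powr (s - 1) * Beta ((s + \<nu>) / 2) ((s - \<nu>) / 2)"
  have 1: "has_bochner_integral lborel (\<lambda>t. exp (\<nu> * t) * cosh t powr (- s)) ?B"
    by (rule has_bochner_integral_exp_cosh_powr[OF assms])
  have 2: "has_bochner_integral lborel (\<lambda>t. exp (- \<nu> * t) * cosh t powr (- s)) ?B"
    using has_bochner_integral_exp_cosh_powr[of "- \<nu>" s] assms by (simp add: Beta_commute)
  have "has_bochner_integral lborel (\<lambda>t. cosh (\<nu> * t) * cosh t powr (- s)) ?B"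
    using has_bochner_integral_mult_right[OF has_bochner_integral_add[OF 1 2], of "1/2"]
    by (simp add: cosh_field_def field_simps)
  from has_bochner_integral_lborel_even[OF _ this] show ?thesis
    by (simp add: powr_diff)
qed

section \<open>The Bessel function and its Mellin transform\<close>

lemma bessel_K_nonneg: "0 \<le> bessel_K \<nu> x"
  unfolding bessel_K_def set_lebesgue_integral_def
  by (intro integral_nonneg_AE) (auto intro!: AE_I2)

lemma borel_measurable_bessel_K [measurable]: "bessel_K \<nu> \<in> borel_measurable borel"
proof -
  have [measurable]: "(cosh :: real \<Rightarrow> real) \<in> borel_measurable borel"
    by (intro borel_measurable_continuous_onI continuous_intros)
  show ?thesis
    unfolding bessel_K_def[abs_def] set_lebesgue_integral_def by measurable
qed

text \<open>Fubini for the double integral in \<open>t\<close> and \<open>x\<close>. Integrating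
  over \<open>x\<close> first gives a Gamma integral with rate \<open>\<alpha> * cosh t\<close>,
  then a Beta integral in \<open>t\<close>; integrating over \<open>t\<close> first gives
  \<open>bessel_K\<close>.\<close>

lemma has_bochner_integral_Mellin_bessel_K:
  fixes s \<nu> \<alpha> :: real
  assumes s: "\<bar>\<nu>\<bar> < s" and \<alpha>: "\<alpha> > 0"
  shows "has_bochner_integral lborel
           (\<lambda>x. indicator {0<..} x * (x powr (s - 1) * bessel_K \<nu> (\<alpha> * x)))
           (2 powr (s - 2) * \<alpha> powr (- s) * Gamma ((s + \<nu>) / 2) * Gamma ((s - \<nu>) / 2))"
proof -
  define f where "f = (\<lambda>t x. (indicator {0..} t * cosh (\<nu> * t)) *
    (indicator {0<..} x * (x powr (s - 1) * exp (- (\<alpha> * cosh t) * x))) :: real)"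
  have [measurable]: "(cosh :: real \<Rightarrow> real) \<in> borel_measurable borel"
    by (intro borel_measurable_continuous_onI continuous_intros)
  have nn: "0 \<le> f t x" for t x by (auto simp: f_def)
  have [measurable]: "case_prod f \<in> borel_measurable (lborel \<Otimes>\<^sub>M lborel)"
    unfolding f_def by measurable
  have inner: "has_bochner_integral lborel (f t)
      (indicator {0..} t * cosh (\<nu> * t) * (Gamma s * (\<alpha> * cosh t) powr (- s)))" for t
    unfolding f_def using assms
    by (intro has_bochner_integral_mult_right has_bochner_integral_Gamma_scaled) auto
  have outer: "has_bochner_integral lborel (\<lambda>t. \<integral>x. f t x \<partial>lborel)
      (2 powr (s - 2) * \<alpha> powr (- s) * Gamma ((s + \<nu>) / 2) * Gamma ((s - \<nu>) / 2))"
  proof -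
    have "(\<lambda>t. \<integral>x. f t x \<partial>lborel) = (\<lambda>t. (Gamma s * \<alpha> powr (- s)) *
        (indicator {0..} t * (cosh (\<nu> * t) * cosh t powr (- s))))"
      using has_bochner_integral_integral_eq[OF inner] \<alpha> by (simp add: fun_eq_iff powr_mult)
    moreover have "(Gamma s * \<alpha> powr (- s)) * (2 powr (s - 2) * Beta ((s + \<nu>) / 2) ((s - \<nu>) / 2)) =
        2 powr (s - 2) * \<alpha> powr (- s) * Gamma ((s + \<nu>) / 2) * Gamma ((s - \<nu>) / 2)"
    proof -
      have "Gamma s > 0" using s by (intro Gamma_real_pos) auto
      \<comment> \<open>The Beta arguments add up to \<open>s\<close>, so \<open>Gamma s\<close>
        cancels the denominator of the Beta function.\<close>
      moreover have "(s + \<nu>) / 2 + (s - \<nu>) / 2 = s" by (simp add: field_simps)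
      ultimately show ?thesis by (simp add: Beta_def)
    qed
    ultimately show ?thesis
      using has_bochner_integral_mult_right[OF has_bochner_integral_cosh_cosh_powr[OF s], of "Gamma s * \<alpha> powr (- s)"]
      by (simp only:)
  qed
  \<comment> \<open>Since \<open>f\<close> is nonnegative, the iterated integral of its norm is the
    one computed in \<open>outer\<close>, hence finite.\<close>
  have int: "integrable (lborel \<Otimes>\<^sub>M lborel) (case_prod f)"
  proof (rule lborel_pair.Fubini_integrable)
    show "integrable lborel (\<lambda>t. \<integral>x. norm (case_prod f (t, x)) \<partial>lborel)"
      using outer nn by (simp add: has_bochner_integral_iff)
    show "AE t in lborel. integrable lborel (\<lambda>x. case_prod f (t, x))"
      using inner by (intro AE_I2) (simp add: has_bochner_integral_iff)
  qed simp
  have eq: "(\<integral>t. f t x \<partial>lborel) = indicator {0<..} x * (x powr (s - 1) * bessel_K \<nu> (\<alpha> * x))" for x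
  proof -
    have "(\<integral>t. f t x \<partial>lborel) = (\<integral>t. (indicator {0<..} x * x powr (s - 1)) *
        (indicator {0..} t *\<^sub>R (exp (- (\<alpha> * x) * cosh t) * cosh (\<nu> * t))) \<partial>lborel)"
      by (intro Bochner_Integration.integral_cong) (auto simp: f_def mult_ac)
    then show ?thesis
      by (simp add: bessel_K_def set_lebesgue_integral_def)
  qed
  show ?thesis
    using lborel_pair.integrable_snd[OF int] lborel_pair.Fubini_integral[OF int]
      has_bochner_integral_integral_eq[OF outer]
    by (simp add: has_bochner_integral_iff eq)
qed

section \<open>Hypergeometric series\<close>

text \<open>Ratio test: consecutive terms have quotient \<open>\<rho> n * z\<close>, and
  \<open>\<rho>\<close> tends to 1.\<close>

lemma summable_hypergeo_2F1:
  fixes a b c z :: real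
  assumes c: "c > 0" and z: "\<bar>z\<bar> < 1"
  shows "summable (\<lambda>n. pochhammer a n * pochhammer b n / (pochhammer c n * fact n) * z ^ n)"
proof -
  define h where "h = (\<lambda>n. pochhammer a n * pochhammer b n / (pochhammer c n * fact n) * z ^ n)"
  define \<rho> where "\<rho> = (\<lambda>n::nat. (a + n) * (b + n) / ((c + n) * (1 + n)))"
  have step: "h (Suc n) = \<rho> n * z * h n" for n
  proof -
    have "pochhammer c n > 0" "c + n > 0" using c by (auto intro: pochhammer_pos)
    then show ?thesis by (simp add: h_def \<rho>_def pochhammer_Suc field_simps)
  qed
  have "(\<lambda>n. \<bar>\<rho> n\<bar> * \<bar>z\<bar>) \<longlonglongrightarrow> \<bar>1\<bar> * \<bar>z\<bar>"
  proof (intro tendsto_intros)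
    have lim: "(\<lambda>n. (x + real n) / (y + real n)) \<longlonglongrightarrow> 1" if "y > 0" for x y
    proof -
      \<comment> \<open>Splitting off 1 from \<open>(x + real n) / (y + real n)\<close> leaves a
        constant over a sequence tending to infinity.\<close>
      have "(\<lambda>n. (x - y) / (y + real n) + 1) \<longlonglongrightarrow> 0 + 1"
        by (intro tendsto_intros tendsto_divide_0[OF tendsto_const] filterlim_at_top_imp_at_infinity
            filterlim_tendsto_add_at_top[OF tendsto_const] filterlim_real_sequentially)
      moreover have "(x - y) / (y + real n) + 1 = (x + real n) / (y + real n)" for n
      proof -
        have "y + real n \<noteq> 0" using that by (simp add: add_pos_nonneg less_imp_neq[symmetric])
        then show ?thesis by (simp add: field_simps)
      qed
      ultimately show ?thesis by simp
    qed
    show "\<rho> \<longlonglongrightarrow> 1"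
      using tendsto_mult[OF lim[OF c, of a] lim[OF zero_less_one, of b]] by (simp add: \<rho>_def)
  qed
  \<comment> \<open>The midpoint of \<open>\<bar>z\<bar>\<close> and 1 serves as the ratio.\<close>
  then have "eventually (\<lambda>n. \<bar>\<rho> n\<bar> * \<bar>z\<bar> < (1 + \<bar>z\<bar>) / 2) sequentially"
    using z by (intro order_tendstoD(2)) auto
  then obtain N where N: "\<bar>\<rho> n\<bar> * \<bar>z\<bar> < (1 + \<bar>z\<bar>) / 2" if "n \<ge> N" for n
    by (auto simp: eventually_sequentially)
  have "summable h"
  proof (rule summable_ratio_test)
    show "(1 + \<bar>z\<bar>) / 2 < 1" using z by simp
    show "norm (h (Suc n)) \<le> (1 + \<bar>z\<bar>) / 2 * norm (h n)" if "n \<ge> N" for n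
      using mult_right_mono[OF less_imp_le[OF N[OF that]], of "\<bar>h n\<bar>"] by (simp add: step abs_mult)
  qed
  then show ?thesis by (simp add: h_def)
qed

text \<open>The equal upper and lower parameters cancel, and the binomial series of
  \<open>(1 - z) powr (- b)\<close> remains.\<close>

lemma hypergeo_2F1_cancel:
  fixes a b z :: real
  assumes a: "a > 0" and z: "\<bar>z\<bar> < 1"
  shows "hypergeo_2F1 a b a z = (1 - z) powr (- b)"
proof -
  have "pochhammer a n * pochhammer b n / (pochhammer a n * fact n) * z ^ n = ((- b) gchoose n) * (- z) ^ n" for n
  proof -
    have "(- 1) ^ n * (- z) ^ n = z ^ n" by (simp flip: power_mult_distrib)
    then show ?thesis using pochhammer_pos[OF a, of n] by (simp add: gbinomial_pochhammer)
  qed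
  moreover have "(\<lambda>n. ((- b) gchoose n) * (- z) ^ n) sums (1 + - z) powr (- b)"
    by (rule gen_binomial_real) (use z in simp)
  ultimately show ?thesis by (simp add: hypergeo_2F1_def sums_iff)
qed

section \<open>The power series of cosh and sinh\<close>

text \<open>Up to \<open>4 ^ n\<close>, the factorials in the cosh series (\<open>q = 0\<close>) and
  the sinh series (\<open>q = 1\<close>) are the denominators of a hypergeometric series with lower
  parameter \<open>1/2 + q\<close>. The odd case rests on (2n+3)(2n+2) = 4(n+1)(n+3/2).\<close>

lemma fact_double_plus_bit:
  assumes "q \<le> 1"
  shows "(fact (2 * n + q) :: real) = 4 ^ n * fact n * pochhammer (1/2 + real q) n"
proof (cases "q = 0")
  case True
  then show ?thesis using fact_double[of n, where 'a = real] by (simp add: power_mult)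
next
  case False
  then have q: "q = 1" using assms by simp
  have "(fact (2 * n + 1) :: real) = 4 ^ n * fact n * pochhammer (1/2 + 1) n"
  proof (induction n)
    case (Suc n)
    have "(fact (2 * Suc n + 1) :: real) = (2 * real n + 3) * ((2 * real n + 2) * fact (2 * n + 1))"
      by (simp add: algebra_simps)
    also have "\<dots> = (2 * real n + 3) * ((2 * real n + 2) * (4 ^ n * fact n * pochhammer (1/2 + 1) n))"
      unfolding Suc.IH ..
    also have "\<dots> = 4 * 4 ^ n * ((real n + 1) * fact n) * (pochhammer (1/2 + 1) n * (1/2 + 1 + real n))"
      by algebra
    finally show ?case by (simp add: pochhammer_Suc add.commute)
  qed simp
  then show ?thesis by (simp add: q)
qed

text \<open>The full series has zeros at the indices of the wrong parity; reindexing along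
  \<open>2 * n\<close> or \<open>2 * n + 1\<close> drops them.\<close>

lemma sums_cosh_sinh:
  fixes y :: real
  assumes "q \<le> 1"
  shows "(\<lambda>n. y ^ (2 * n + q) / fact (2 * n + q)) sums (if q = 0 then cosh y else sinh y)"
proof (cases "q = 0")
  case True
  have "(\<lambda>n. if even (2 * n) then y ^ (2 * n) /\<^sub>R fact (2 * n) else 0) sums cosh y"
    by (subst sums_mono_reindex[of "\<lambda>n. 2 * n"]) (auto simp: strict_mono_def cosh_converges elim!: evenE)
  with True show ?thesis by (simp add: divide_inverse mult.commute)
next
  case False
  then have q: "q = 1" using assms by simp
  have "(\<lambda>n. if even (2 * n + 1) then 0 else y ^ (2 * n + 1) /\<^sub>R fact (2 * n + 1)) sums sinh y"
    by (subst sums_mono_reindex[of "\<lambda>n. 2 * n + 1"]) (auto simp: strict_mono_def sinh_converges elim!: oddE)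
  with q show ?thesis by (simp add: divide_inverse mult.commute)
qed

section \<open>Termwise integration against the Bessel function\<close>

text \<open>The Mellin transform at \<open>s = \<nu> + j + 1\<close>. Its condition
  \<bar>\<nu>\<bar> < s holds for all \<open>j\<close> because 2\<nu> + 1 > 0.\<close>

lemma has_bochner_integral_power_bessel_K:
  fixes \<nu> \<alpha> :: real and j :: nat
  assumes "\<nu> > -1/2" and "\<alpha> > 0"
  shows "has_bochner_integral lborel
           (\<lambda>x. indicator {0<..} x * (x ^ j * (x powr \<nu> * bessel_K \<nu> (\<alpha> * x))))
           (2 powr (\<nu> + j - 1) * \<alpha> powr (- (\<nu> + j + 1)) * Gamma (\<nu> + (real j + 1) / 2) * Gamma ((real j + 1) / 2))"
proof -
  define s where "s = \<nu> + j + 1"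
  have "has_bochner_integral lborel
           (\<lambda>x. indicator {0<..} x * (x powr (s - 1) * bessel_K \<nu> (\<alpha> * x)))
           (2 powr (s - 2) * \<alpha> powr (- s) * Gamma ((s + \<nu>) / 2) * Gamma ((s - \<nu>) / 2))"
    using assms by (intro has_bochner_integral_Mellin_bessel_K) (auto simp: s_def)
  also have "(\<lambda>x. indicator {0<..} x * (x powr (s - 1) * bessel_K \<nu> (\<alpha> * x))) =
      (\<lambda>x. indicator {0<..} x * (x ^ j * (x powr \<nu> * bessel_K \<nu> (\<alpha> * x))))"
    by (auto simp: indicator_def fun_eq_iff s_def powr_add powr_realpow)
  also have "(s + \<nu>) / 2 = \<nu> + (real j + 1) / 2" by (simp add: s_def field_simps)
  also have "(s - \<nu>) / 2 = (real j + 1) / 2" by (simp add: s_def)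
  also have "s - 2 = \<nu> + j - 1" by (simp add: s_def)
  finally show ?thesis by (simp add: s_def)
qed

text \<open>Expand cosh or sinh and integrate each power. The \<open>4 ^ n\<close> from the Mellin
  transform cancels the one from the factorial, and the two Gamma factors yield the upper Pochhammer
  symbols; \<open>p\<close> is the second Gamma argument at \<open>n = 0\<close>.\<close>

lemma has_bochner_integral_cosh_sinh_bessel_K:
  fixes \<nu> \<alpha> \<beta> :: real and k q :: nat
  assumes \<nu>: "\<nu> > -1/2" and \<beta>: "\<bar>\<beta>\<bar> < \<alpha>" and q: "q \<le> 1"
  defines "p \<equiv> (real k + real q + 1) / 2"
  shows "has_bochner_integral lborel
           (\<lambda>x. indicator {0<..} x * (x ^ k * (if q = 0 then cosh (\<beta> * x) else sinh (\<beta> * x))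
                  * (x powr \<nu> * bessel_K \<nu> (\<alpha> * x))))
           (\<beta> ^ q * 2 powr (\<nu> + k + q - 1) * \<alpha> powr (- (\<nu> + k + q + 1)) * Gamma (\<nu> + p) * Gamma p
              * hypergeo_2F1 p (\<nu> + p) (1/2 + real q) (\<beta>\<^sup>2 / \<alpha>\<^sup>2))"
    (is "has_bochner_integral _ ?F _")
proof -
  have \<alpha>: "\<alpha> > 0" using \<beta> by simp
  define w where "w = (\<lambda>x. x powr \<nu> * bessel_K \<nu> (\<alpha> * x))"
  define h where "h = (\<lambda>n. pochhammer p n * pochhammer (\<nu> + p) n / (pochhammer (1/2 + real q) n * fact n)
    * (\<beta>\<^sup>2 / \<alpha>\<^sup>2) ^ n)"
  have "1/2 \<le> p" by (simp add: p_def)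
  then have p: "p > 0" "\<nu> + p > 0" using \<nu> by auto
  have z: "\<bar>\<beta>\<^sup>2 / \<alpha>\<^sup>2\<bar> < 1"
    using \<beta> \<alpha> abs_square_less_1[of "\<beta> / \<alpha>"] by (simp add: power_divide)
  have h: "h sums hypergeo_2F1 p (\<nu> + p) (1/2 + real q) (\<beta>\<^sup>2 / \<alpha>\<^sup>2)"
    unfolding h_def hypergeo_2F1_def using z by (intro summable_sums summable_hypergeo_2F1) auto
  define f where "f = (\<lambda>b n x. indicator {0<..} x * (x ^ k * ((b * x) ^ (2 * n + q) / fact (2 * n + q)) * w x) :: real)"
  define C where "C = 2 powr (\<nu> + k + q - 1) * \<alpha> powr (- (\<nu> + k + q + 1)) * Gamma (\<nu> + p) * Gamma p"
  \<comment> \<open>Kept general in \<open>b\<close> because it is applied to \<beta>, for the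
    terms, and to \<bar>\<beta>\<bar>, for their norms.\<close>
  have f: "has_bochner_integral lborel (f b n) (b ^ q * C * h n)" if b: "b\<^sup>2 = \<beta>\<^sup>2" for b n
  proof -
    define j where "j = k + (2 * n + q)"
    have "has_bochner_integral lborel
        (\<lambda>x. b ^ (2 * n + q) / fact (2 * n + q) * (indicator {0<..} x * (x ^ j * w x)))
        (b ^ (2 * n + q) / fact (2 * n + q) *
          (2 powr (\<nu> + j - 1) * \<alpha> powr (- (\<nu> + j + 1)) * Gamma (\<nu> + (real j + 1) / 2) * Gamma ((real j + 1) / 2)))"
      unfolding w_def by (intro has_bochner_integral_mult_right has_bochner_integral_power_bessel_K \<nu> \<alpha>)
    also have "(\<lambda>x. b ^ (2 * n + q) / fact (2 * n + q) * (indicator {0<..} x * (x ^ j * w x))) = f b n"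
      by (auto simp: f_def fun_eq_iff j_def power_mult_distrib power_add)
    also have "(real j + 1) / 2 = p + n" by (simp add: j_def p_def field_simps)
    also have "Gamma (p + n) = pochhammer p n * Gamma p"
      using p by (subst pochhammer_Gamma) (auto elim!: nonpos_Ints_cases simp: Gamma_eq_zero_iff)
    also have "\<nu> + (p + n) = (\<nu> + p) + n" by simp
    also have "Gamma ((\<nu> + p) + n) = pochhammer (\<nu> + p) n * Gamma (\<nu> + p)"
      using p by (subst pochhammer_Gamma) (auto elim!: nonpos_Ints_cases simp: Gamma_eq_zero_iff)
    also have "2 powr (\<nu> + j - 1) = 2 powr (\<nu> + k + q - 1) * 4 ^ n"
    proof -
      have "2 powr (\<nu> + j - 1) = 2 powr ((\<nu> + k + q - 1) + real (2 * n))" by (simp add: j_def algebra_simps)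
      also have "\<dots> = 2 powr (\<nu> + k + q - 1) * 2 ^ (2 * n)" by (simp only: powr_add powr_realpow zero_less_numeral)
      finally show ?thesis by (simp add: power_mult)
    qed
    also have "\<alpha> powr (- (\<nu> + j + 1)) = \<alpha> powr (- (\<nu> + k + q + 1)) / (\<alpha>\<^sup>2) ^ n"
    proof -
      have "\<alpha> powr (- (\<nu> + j + 1)) = \<alpha> powr (- (\<nu> + k + q + 1) - real (2 * n))" by (simp add: j_def algebra_simps)
      also have "\<dots> = \<alpha> powr (- (\<nu> + k + q + 1)) / \<alpha> ^ (2 * n)" using \<alpha> by (simp only: powr_diff powr_realpow)
      finally show ?thesis by (simp add: power_mult)
    qed
    also have "b ^ (2 * n + q) = b ^ q * (\<beta>\<^sup>2) ^ n" by (simp add: power_add power_mult b)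
    also have "fact (2 * n + q) = 4 ^ n * fact n * pochhammer (1/2 + real q) n"
      by (rule fact_double_plus_bit[OF q])
    also have "b ^ q * (\<beta>\<^sup>2) ^ n / (4 ^ n * fact n * pochhammer (1/2 + real q) n) *
          (2 powr (\<nu> + k + q - 1) * 4 ^ n * (\<alpha> powr (- (\<nu> + k + q + 1)) / (\<alpha>\<^sup>2) ^ n)
            * (pochhammer (\<nu> + p) n * Gamma (\<nu> + p)) * (pochhammer p n * Gamma p)) = b ^ q * C * h n"
      by (simp add: C_def h_def power_divide mult_ac)
    finally show ?thesis .
  qed
  have sums: "(\<lambda>n. f b n x) sums (indicator {0<..} x * (x ^ k * (if q = 0 then cosh (b * x) else sinh (b * x)) * w x))" for b x
    unfolding f_def by (rule sums_mult, rule sums_mult2, rule sums_mult, rule sums_cosh_sinh[OF q])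
  have norm_f: "norm (f \<beta> n x) = f \<bar>\<beta>\<bar> n x" for n x
  proof -
    have "\<bar>w x\<bar> = w x" by (simp add: w_def bessel_K_nonneg)
    then show ?thesis by (cases "x > 0") (simp_all add: f_def abs_mult power_abs)
  qed
  have prems: "\<And>n. integrable lborel (f \<beta> n)" "AE x in lborel. summable (\<lambda>n. norm (f \<beta> n x))"
    "summable (\<lambda>n. \<integral>x. norm (f \<beta> n x) \<partial>lborel)"
  proof -
    show "integrable lborel (f \<beta> n)" for n using f[OF refl, of n] by (simp add: has_bochner_integral_iff)
    show "AE x in lborel. summable (\<lambda>n. norm (f \<beta> n x))"
      unfolding norm_f using sums by (intro AE_I2) (auto simp: sums_iff)
    \<comment> \<open>The norms integrate to multiples of the terms of the convergent hypergeometric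
      series, which justifies exchanging sum and integral.\<close>
    have "(\<integral>x. norm (f \<beta> n x) \<partial>lborel) = \<bar>\<beta>\<bar> ^ q * C * h n" for n
      unfolding norm_f by (rule has_bochner_integral_integral_eq[OF f]) simp
    then show "summable (\<lambda>n. \<integral>x. norm (f \<beta> n x) \<partial>lborel)"
      using h by (simp add: summable_mult sums_iff)
  qed
  have eq: "(\<lambda>x. \<Sum>n. f \<beta> n x) = ?F" using sums[of \<beta>] by (simp add: sums_iff w_def fun_eq_iff)
  have "integral\<^sup>L lborel ?F = (\<Sum>n. \<beta> ^ q * C * h n)"
    using integral_suminf[OF prems] has_bochner_integral_integral_eq[OF f[OF refl]] by (simp add: eq)
  also have "\<dots> = \<beta> ^ q * C * hypergeo_2F1 p (\<nu> + p) (1/2 + real q) (\<beta>\<^sup>2 / \<alpha>\<^sup>2)"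
    using h by (simp add: suminf_mult sums_iff)
  finally show ?thesis
    using integrable_suminf[OF prems] by (simp add: has_bochner_integral_iff eq C_def mult_ac)
qed

section \<open>Moments of the variance-gamma distribution\<close>

text \<open>Rounding k/2 up adds half the parity bit. This form agrees with \<open>p\<close> in the
  integrals above when \<open>q\<close> is the parity of \<open>k\<close>.\<close>

lemma p_idx_eq: "p_idx k = (real k + real (q_idx k) + 1) / 2"
proof (cases "even k")
  case True
  then obtain m where "k = 2 * m" by (elim evenE)
  then show ?thesis by (simp add: p_idx_def q_idx_def field_simps)
next
  case False
  then obtain m where k: "k = 2 * m + 1" by (elim oddE)
  have "\<lceil>real k / 2\<rceil> = int m + 1"
    by (rule ceiling_unique) (simp_all add: k field_simps)
  moreover have "q_idx k = 1" by (simp add: q_idx_def k)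
  ultimately show ?thesis by (simp add: p_idx_def k field_simps)
qed

lemma vg_density_nonneg:
  assumes "\<nu> > -1/2"
  shows "0 \<le> vg_density \<nu> \<alpha> \<beta> \<mu> x"
  using assms Gamma_real_pos[of "\<nu> + 1/2"] unfolding vg_density_def
  by (intro mult_nonneg_nonneg divide_nonneg_nonneg bessel_K_nonneg) auto

lemma borel_measurable_vg_density [measurable]: "vg_density \<nu> \<alpha> \<beta> \<mu> \<in> borel_measurable borel"
  unfolding vg_density_def[abs_def] by measurable

text \<open>The moment of order \<open>k\<close> about the location parameter.\<close>

definition vg_raw_moment :: "real \<Rightarrow> real \<Rightarrow> real \<Rightarrow> nat \<Rightarrow> real" where
  "vg_raw_moment \<nu> \<alpha> \<beta> k =
     (1 - \<beta>\<^sup>2 / \<alpha>\<^sup>2) powr (\<nu> + 1/2) / (sqrt pi * \<alpha> ^ k * Gamma (\<nu> + 1/2))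
       * (2 ^ k * (2 * \<beta> / \<alpha>) ^ q_idx k * Gamma (\<nu> + p_idx k) * Gamma (p_idx k)
          * hypergeo_2F1 (p_idx k) (\<nu> + p_idx k) (1/2 + real (q_idx k)) (\<beta>\<^sup>2 / \<alpha>\<^sup>2))"

text \<open>Bookkeeping of exponents: those of \<alpha> add up to -(k+q) and those of 2 to k+q. The
  leading factor 2 accounts for the two half-lines.\<close>

lemma vg_normalization:
  fixes \<nu> \<alpha> \<beta> :: real
  assumes \<beta>: "\<bar>\<beta>\<bar> < \<alpha>"
  shows "(\<alpha>\<^sup>2 - \<beta>\<^sup>2) powr (\<nu> + 1/2) / (2 * \<alpha>) powr \<nu> * (2 * 2 powr (\<nu> + k + q - 1) * \<alpha> powr (- (\<nu> + k + q + 1)))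
    = (1 - \<beta>\<^sup>2 / \<alpha>\<^sup>2) powr (\<nu> + 1/2) / \<alpha> ^ k * 2 ^ k * (2 / \<alpha>) ^ q" (is "?L = ?R")
proof -
  have \<alpha>: "\<alpha> > 0" using \<beta> by simp
  define e where "e = 1 - \<beta>\<^sup>2 / \<alpha>\<^sup>2"
  \<comment> \<open>Factoring out the square of \<alpha> isolates the scale-free quantity
    \<open>e\<close>.\<close>
  have "\<alpha>\<^sup>2 - \<beta>\<^sup>2 = \<alpha>\<^sup>2 * e" using \<alpha> by (simp add: e_def field_simps)
  moreover have "(\<alpha>\<^sup>2) powr (\<nu> + 1/2) = \<alpha> powr (2 * \<nu> + 1)"
    using \<alpha> by (simp add: powr_powr flip: powr_numeral)
  moreover have "0 \<le> e" using \<beta> \<alpha> abs_square_less_1[of "\<beta> / \<alpha>"] by (simp add: e_def power_divide)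
  ultimately have 1: "(\<alpha>\<^sup>2 - \<beta>\<^sup>2) powr (\<nu> + 1/2) = \<alpha> powr (2 * \<nu> + 1) * e powr (\<nu> + 1/2)"
    by (simp add: powr_mult)
  have 2: "2 * 2 powr (\<nu> + k + q - 1) = 2 powr \<nu> * 2 ^ k * (2::real) ^ q"
    by (simp add: powr_add powr_diff powr_realpow)
  have "\<alpha> powr (2 * \<nu> + 1) = \<alpha> powr \<nu> * \<alpha> powr (\<nu> + k + q + 1) / (\<alpha> ^ k * \<alpha> ^ q)"
  proof -
    have "\<alpha> powr (2 * \<nu> + 1) = \<alpha> powr (\<nu> + (\<nu> + k + q + 1) - (real k + real q))" by (simp add: algebra_simps)
    also have "\<dots> = \<alpha> powr \<nu> * \<alpha> powr (\<nu> + k + q + 1) / (\<alpha> ^ k * \<alpha> ^ q)"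
      unfolding powr_diff powr_add[of _ \<nu>] powr_add[of _ "real k"] powr_realpow[OF \<alpha>] ..
    finally show ?thesis .
  qed
  then have "?L = (\<alpha> powr \<nu> * \<alpha> powr (\<nu> + k + q + 1) / (\<alpha> ^ k * \<alpha> ^ q)) * e powr (\<nu> + 1/2)
      / (2 powr \<nu> * \<alpha> powr \<nu>) * (2 powr \<nu> * 2 ^ k * 2 ^ q / \<alpha> powr (\<nu> + k + q + 1))"
    using \<alpha> by (simp only: 1 2 powr_mult powr_minus_divide) simp
  also have "\<dots> = ?R"
    using \<alpha> by (simp add: e_def power_divide)
  finally show ?thesis .
qed

text \<open>The exponential is cosh + sinh on the positive half-line, and cosh - sinh with the sign
  \<open>(- 1) ^ k\<close> after reflecting the negative one. In the sum only the part with the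
  parity of \<open>k\<close> survives, doubled.\<close>

lemma has_bochner_integral_vg_raw_moment:
  fixes \<nu> \<alpha> \<beta> :: real and k :: nat
  assumes \<nu>: "\<nu> > -1/2" and \<beta>: "\<bar>\<beta>\<bar> < \<alpha>"
  shows "has_bochner_integral lborel (\<lambda>x. vg_density \<nu> \<alpha> \<beta> 0 x * x ^ k) (vg_raw_moment \<nu> \<alpha> \<beta> k)"
proof -
  define c where "c = (\<alpha>\<^sup>2 - \<beta>\<^sup>2) powr (\<nu> + 1/2) / (sqrt pi * (2 * \<alpha>) powr \<nu> * Gamma (\<nu> + 1/2))"
  define w where "w = (\<lambda>x. x powr \<nu> * bessel_K \<nu> (\<alpha> * x))"
  define p where "p = (\<lambda>q. (real k + real q + 1) / 2)"
  \<comment> \<open>\<open>J 0\<close> is the cosh integral and \<open>J 1\<close> the sinh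
    integral.\<close>
  define J where "J = (\<lambda>q::nat. \<beta> ^ q * 2 powr (\<nu> + k + q - 1) * \<alpha> powr (- (\<nu> + k + q + 1))
    * Gamma (\<nu> + p q) * Gamma (p q) * hypergeo_2F1 (p q) (\<nu> + p q) (1/2 + real q) (\<beta>\<^sup>2 / \<alpha>\<^sup>2))"
  have ch: "has_bochner_integral lborel (\<lambda>x. indicator {0<..} x * (x ^ k * cosh (\<beta> * x) * w x)) (J 0)"
    using has_bochner_integral_cosh_sinh_bessel_K[OF \<nu> \<beta>, of 0 k] by (simp add: J_def p_def w_def)
  have sh: "has_bochner_integral lborel (\<lambda>x. indicator {0<..} x * (x ^ k * sinh (\<beta> * x) * w x)) (J 1)"
    using has_bochner_integral_cosh_sinh_bessel_K[OF \<nu> \<beta>, of 1 k] by (simp add: J_def p_def w_def)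
  let ?F = "\<lambda>x. vg_density \<nu> \<alpha> \<beta> 0 x * x ^ k"
  have "has_bochner_integral lborel ?F (c * (J 0 + J 1) + (- 1) ^ k * c * (J 0 - J 1))"
  proof (rule has_bochner_integral_lborel_half_lines)
    have "indicator {0<..} x * ?F x = c * (indicator {0<..} x * (x ^ k * cosh (\<beta> * x) * w x)
        + indicator {0<..} x * (x ^ k * sinh (\<beta> * x) * w x))" for x
      by (cases "x > 0") (simp_all add: vg_density_def c_def w_def flip: cosh_plus_sinh distrib_left distrib_right)
    then show "has_bochner_integral lborel (\<lambda>x. indicator {0<..} x * ?F x) (c * (J 0 + J 1))"
      using has_bochner_integral_mult_right[OF has_bochner_integral_add[OF ch sh], of c] by simp
    have "indicator {0<..} x * ?F (- x) = (- 1) ^ k * c * (indicator {0<..} x * (x ^ k * cosh (\<beta> * x) * w x)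
        - indicator {0<..} x * (x ^ k * sinh (\<beta> * x) * w x))" for x
    proof (cases "x > 0")
      case True
      have "(- x) ^ k = (- 1) ^ k * x ^ k" by (rule power_minus)
      with True show ?thesis
        using cosh_minus_sinh[of "\<beta> * x"]
        by (simp add: vg_density_def c_def w_def flip: left_diff_distrib right_diff_distrib)
    qed simp
    then show "has_bochner_integral lborel (\<lambda>x. indicator {0<..} x * ?F (- x)) ((- 1) ^ k * c * (J 0 - J 1))"
      using has_bochner_integral_mult_right[OF has_bochner_integral_diff[OF ch sh], of "(- 1) ^ k * c"] by simp
  qed simp
  also have "c * (J 0 + J 1) + (- 1) ^ k * c * (J 0 - J 1) = 2 * c * J (q_idx k)"
    by (cases "even k") (auto simp: q_idx_def algebra_simps odd_iff_mod_2_eq_one)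
  also have "\<dots> = vg_raw_moment \<nu> \<alpha> \<beta> k"
  proof -
    define q where "q = q_idx k"
    have p: "p_idx k = p q" by (simp add: p_idx_eq p_def q_def)
    define H where "H = Gamma (\<nu> + p q) * Gamma (p q) * hypergeo_2F1 (p q) (\<nu> + p q) (1/2 + real q) (\<beta>\<^sup>2 / \<alpha>\<^sup>2)"
    have "2 * c * J q = ((\<alpha>\<^sup>2 - \<beta>\<^sup>2) powr (\<nu> + 1/2) / (2 * \<alpha>) powr \<nu> *
        (2 * 2 powr (\<nu> + k + q - 1) * \<alpha> powr (- (\<nu> + k + q + 1)))) * (\<beta> ^ q * H / (sqrt pi * Gamma (\<nu> + 1/2)))"
      by (simp add: c_def J_def H_def mult_ac)
    also have "\<dots> = vg_raw_moment \<nu> \<alpha> \<beta> k"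
      unfolding vg_normalization[OF \<beta>]
      by (simp add: vg_raw_moment_def p H_def power_divide power_mult_distrib mult_ac flip: q_def)
    finally show ?thesis by (simp add: q_def)
  qed
  finally show ?thesis .
qed

text \<open>At order 1 the index \<open>p_idx 1\<close> equals the lower parameter 3/2, so the
  series is a pure power of \<open>e\<close>; against the prefactor only \<open>1 / e\<close>
  remains, and the Gamma quotient contributes \<nu> + 1/2.\<close>

lemma vg_raw_moment_1:
  fixes \<nu> \<alpha> \<beta> :: real
  assumes \<nu>: "\<nu> > -1/2" and \<beta>: "\<bar>\<beta>\<bar> < \<alpha>"
  shows "vg_raw_moment \<nu> \<alpha> \<beta> 1 = (2 * \<nu> + 1) * \<beta> / (\<alpha>\<^sup>2 - \<beta>\<^sup>2)"
proof -
  have \<alpha>: "\<alpha> > 0" using \<beta> by simp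
  define e where "e = 1 - \<beta>\<^sup>2 / \<alpha>\<^sup>2"
  have z: "\<beta>\<^sup>2 / \<alpha>\<^sup>2 < 1"
    using \<beta> \<alpha> abs_square_less_1[of "\<beta> / \<alpha>"] by (simp add: power_divide)
  then have e: "e > 0" by (simp add: e_def)
  have q: "q_idx 1 = 1" by (simp add: q_idx_def)
  have p: "p_idx 1 = 3/2" by (simp only: p_idx_eq q) simp
  have "hypergeo_2F1 (3/2) (\<nu> + 3/2) (3/2) (\<beta>\<^sup>2 / \<alpha>\<^sup>2) = e powr (- (\<nu> + 3/2))"
    unfolding e_def using z by (intro hypergeo_2F1_cancel) auto
  also have "\<dots> = 1 / (e powr (\<nu> + 1/2) * e)"
    using e powr_add[of e "\<nu> + 1/2" 1] by (subst powr_minus_divide) (simp add: add.assoc)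
  finally have F: "hypergeo_2F1 (3/2) (\<nu> + 3/2) (3/2) (\<beta>\<^sup>2 / \<alpha>\<^sup>2) = 1 / (e powr (\<nu> + 1/2) * e)" .
  have "Gamma (\<nu> + 1/2 + 1) = (\<nu> + 1/2) * Gamma (\<nu> + 1/2)"
    using \<nu> by (intro Gamma_plus1) (auto elim!: nonpos_Ints_cases)
  then have G1: "Gamma (\<nu> + 3/2) = (\<nu> + 1/2) * Gamma (\<nu> + 1/2)" by (simp add: add.assoc)
  have "Gamma (1/2 + 1 :: real) = 1/2 * Gamma (1/2)"
    by (intro Gamma_plus1) (auto elim!: nonpos_Ints_cases)
  then have G2: "Gamma (3/2 :: real) = sqrt pi / 2" by (simp add: Gamma_one_half_real)
  have G0: "Gamma (\<nu> + 1/2) > 0" using \<nu> by (intro Gamma_real_pos) auto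
  have ee: "\<alpha>\<^sup>2 - \<beta>\<^sup>2 = \<alpha>\<^sup>2 * e" using \<alpha> by (simp add: e_def field_simps)
  have half: "1/2 + real 1 = 3/2" by simp
  have "vg_raw_moment \<nu> \<alpha> \<beta> 1 = e powr (\<nu> + 1/2) / (sqrt pi * \<alpha> * Gamma (\<nu> + 1/2)) *
      (2 * (2 * \<beta> / \<alpha>) * ((\<nu> + 1/2) * Gamma (\<nu> + 1/2)) * (sqrt pi / 2) * (1 / (e powr (\<nu> + 1/2) * e)))"
    by (simp only: vg_raw_moment_def p q half F G1 G2 power_one_right flip: e_def)
  also have "\<dots> = (2 * \<nu> + 1) * \<beta> / (\<alpha>\<^sup>2 * e)"
    using \<alpha> e G0 by (simp add: field_simps power2_eq_square)
  finally show ?thesis by (simp add: ee)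
qed

section \<open>From the density to random variables\<close>

text \<open>The density depends on \<open>x\<close> and \<mu> only through their difference, and a
  translation has Jacobian 1.\<close>

lemma has_VG_diff_const:
  assumes "prob_space M" and "has_VG M X \<nu> \<alpha> \<beta> \<mu>"
  shows "has_VG M (\<lambda>\<omega>. X \<omega> - c) \<nu> \<alpha> \<beta> (\<mu> - c)"
  using prob_space.distributed_affine[OF assms(1) assms(2)[unfolded has_VG_def], of 1 "- c"]
  by (simp add: has_VG_def vg_density_def algebra_simps divide_ennreal_def)

lemma has_VG_raw_moment:
  assumes "has_VG M Z \<nu> \<alpha> \<beta> 0" and \<nu>: "\<nu> > -1/2" and \<beta>: "\<bar>\<beta>\<bar> < \<alpha>"
  shows "has_bochner_integral M (\<lambda>\<omega>. Z \<omega> ^ k) (vg_raw_moment \<nu> \<alpha> \<beta> k)"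
proof -
  have D: "distributed M lborel Z (\<lambda>x. ennreal (vg_density \<nu> \<alpha> \<beta> 0 x))"
    using assms(1) by (simp add: has_VG_def)
  have m: "(\<lambda>x::real. x ^ k) \<in> borel_measurable lborel" by simp
  note nn = vg_density_nonneg[OF \<nu>]
  show ?thesis
    using has_bochner_integral_vg_raw_moment[OF \<nu> \<beta>, of k] distributed_integral[OF D m nn]
      distributed_integrable[OF D m nn] by (simp add: has_bochner_integral_iff)
qed

theorem mainTheorem6:
  fixes M :: "'a measure" and X :: "'a \<Rightarrow> real" and \<nu> \<alpha> \<beta> \<mu> \<mu>\<^sub>0 :: real
  assumes "prob_space M"
    and "\<nu> > -1/2" and "0 \<le> \<bar>\<beta>\<bar>" and "\<bar>\<beta>\<bar> < \<alpha>"
    and "has_VG M X \<nu> \<alpha> \<beta> \<mu>"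
    and "\<mu>\<^sub>0 = - ((2 * \<nu> + 1) * \<beta>) / (\<alpha>\<^sup>2 - \<beta>\<^sup>2)"
  shows "integrable M X
    \<and> has_VG M (\<lambda>\<omega>. X \<omega> - prob_space.expectation M X) \<nu> \<alpha> \<beta> \<mu>\<^sub>0
    \<and> (\<forall>r::nat. even r \<and> r \<ge> 2 \<longrightarrow>
         integrable M (\<lambda>\<omega>. \<bar>X \<omega> - prob_space.expectation M X\<bar> ^ r)
         \<and> prob_space.expectation M (\<lambda>\<omega>. \<bar>X \<omega> - prob_space.expectation M X\<bar> ^ r)
           = (1 - \<beta>\<^sup>2 / \<alpha>\<^sup>2) powr (\<nu> + 1/2) / (sqrt pi * \<alpha> ^ r * Gamma (\<nu> + 1/2))
             * (\<Sum>k=0..r. real (r choose k) * 2 ^ k * (\<alpha> * \<mu>\<^sub>0) ^ (r - k)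
                 * (2 * \<beta> / \<alpha>) ^ q_idx k * Gamma (\<nu> + p_idx k) * Gamma (p_idx k)
                 * hypergeo_2F1 (p_idx k) (\<nu> + p_idx k) (1/2 + real (q_idx k)) (\<beta>\<^sup>2 / \<alpha>\<^sup>2)))"
proof -
  interpret prob_space M by fact
  note \<nu> = assms(2) and \<beta> = assms(4)
  have \<alpha>: "\<alpha> > 0" using \<beta> by simp
  \<comment> \<open>Centring at the location first makes all moments available before the mean of
    \<open>X\<close> is known.\<close>
  define Z where "Z = (\<lambda>\<omega>. X \<omega> - \<mu>)"
  have Z_VG: "has_VG M Z \<nu> \<alpha> \<beta> 0"
    using has_VG_diff_const[OF assms(1,5), of \<mu>] by (simp add: Z_def)
  note moment = has_VG_raw_moment[OF Z_VG \<nu> \<beta>]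
  have m1: "vg_raw_moment \<nu> \<alpha> \<beta> 1 = - \<mu>\<^sub>0"
    by (simp only: vg_raw_moment_1[OF \<nu> \<beta>] assms(6) minus_divide_left minus_minus)
  have "has_bochner_integral M Z (- \<mu>\<^sub>0)"
    using moment[of 1] by (simp only: m1 power_one_right)
  moreover have "has_bochner_integral M (\<lambda>_. \<mu>) \<mu>"
    by (simp add: has_bochner_integral_iff prob_space)
  ultimately have "has_bochner_integral M (\<lambda>\<omega>. Z \<omega> + \<mu>) (- \<mu>\<^sub>0 + \<mu>)"
    by (rule has_bochner_integral_add)
  then have X: "has_bochner_integral M X (\<mu> - \<mu>\<^sub>0)"
    by (simp add: Z_def)
  then have EX: "expectation X = \<mu> - \<mu>\<^sub>0" by (rule has_bochner_integral_integral_eq)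
  \<comment> \<open>\<open>Z\<close> has mean \<open>- \<mu>\<^sub>0\<close>, so centring adds
    \<open>\<mu>\<^sub>0\<close>.\<close>
  have centred: "X \<omega> - expectation X = Z \<omega> + \<mu>\<^sub>0" for \<omega> by (simp add: Z_def EX)
  have "has_VG M (\<lambda>\<omega>. X \<omega> - expectation X) \<nu> \<alpha> \<beta> \<mu>\<^sub>0"
    using has_VG_diff_const[OF assms(1,5), of "expectation X"] by (simp add: EX)
  moreover have "has_bochner_integral M (\<lambda>\<omega>. \<bar>X \<omega> - expectation X\<bar> ^ r)
      ((1 - \<beta>\<^sup>2 / \<alpha>\<^sup>2) powr (\<nu> + 1/2) / (sqrt pi * \<alpha> ^ r * Gamma (\<nu> + 1/2))
             * (\<Sum>k=0..r. real (r choose k) * 2 ^ k * (\<alpha> * \<mu>\<^sub>0) ^ (r - k)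
                 * (2 * \<beta> / \<alpha>) ^ q_idx k * Gamma (\<nu> + p_idx k) * Gamma (p_idx k)
                 * hypergeo_2F1 (p_idx k) (\<nu> + p_idx k) (1/2 + real (q_idx k)) (\<beta>\<^sup>2 / \<alpha>\<^sup>2)))"
    (is "has_bochner_integral M _ (?c * sum ?t _)") if "even r" for r
  proof -
    \<comment> \<open>Binomial expansion of \<open>(Z \<omega> + \<mu>\<^sub>0) ^ r\<close>, which
      equals the absolute power as \<open>r\<close> is even. For \<beta> = 0 the shift is 0, and
      \<open>0 ^ 0 = 1\<close> keeps the term \<open>k = r\<close>.\<close>
    have "has_bochner_integral M (\<lambda>\<omega>. \<Sum>k\<le>r. (real (r choose k) * \<mu>\<^sub>0 ^ (r - k)) * Z \<omega> ^ k)
        (\<Sum>k\<le>r. (real (r choose k) * \<mu>\<^sub>0 ^ (r - k)) * vg_raw_moment \<nu> \<alpha> \<beta> k)"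
      by (intro has_bochner_integral_sum has_bochner_integral_mult_right moment)
    also have "(\<lambda>\<omega>. \<Sum>k\<le>r. (real (r choose k) * \<mu>\<^sub>0 ^ (r - k)) * Z \<omega> ^ k) = (\<lambda>\<omega>. \<bar>X \<omega> - expectation X\<bar> ^ r)"
      unfolding power_even_abs[OF that] centred binomial_ring by (simp add: mult_ac)
    also have "(\<Sum>k\<le>r. (real (r choose k) * \<mu>\<^sub>0 ^ (r - k)) * vg_raw_moment \<nu> \<alpha> \<beta> k) = ?c * sum ?t {0..r}"
      unfolding sum_distrib_left atLeast0AtMost
    proof (intro sum.cong refl)
      fix k assume "k \<in> {..r}"
      \<comment> \<open>The first factor is the denominator in \<open>vg_raw_moment\<close>; the
        second is absorbed into \<open>(\<alpha> * \<mu>\<^sub>0) ^ (r - k)\<close>.\<close>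
      then have "\<alpha> ^ r = \<alpha> ^ k * \<alpha> ^ (r - k)" by (simp flip: power_add)
      then show "real (r choose k) * \<mu>\<^sub>0 ^ (r - k) * vg_raw_moment \<nu> \<alpha> \<beta> k = ?c * ?t k"
        using \<alpha> by (simp add: vg_raw_moment_def power_mult_distrib mult_ac)
    qed
    finally show ?thesis .
  qed
  ultimately show ?thesis using X by (simp add: has_bochner_integral_iff)
qed

end
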